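(* Let $n$ be a positive integer and let $H \subset \mathbb{R}^n$ be an $n$-dimensional hypercube of edge length $a>0$. For each positive integer $m$, let $r_n(m)$ be the ratio of the arithmetic mean of the volumes of all grid hypercubes of $H$ (for the grid dividing each edge of $H$ into $m$ equal segments) to the volume $a^n$ of $H$. Then the value $r_n = \lim_{m\to\infty} r_n(m)$ of the ratio of the volume of a normal-sized hypercube to the volume of $H$ is \[ r_n = \frac{1}{\binom{2n+1}{n}}. \]
   Context: Write the hypercube as $H=\{v+\sum_{i=1}^n t_i e_i : 0\le t_i\le a\}$, where $v\in\mathbb{R}^n$ is a vertex and $e_1,\dots,e_n$ is an orthonormal basis of $\mathbb{R}^n$ consisting of the directions of the edges. Draw grid lines parallel to the edges dividing each edge of $H$ into $m$ equal segments. The grid hypercubes of $H$ are all $n$-dimensional hypercubes in $H$ whose edges lie on the grid lines or the boundary, that is, all sets $\{v+\sum_{i=1}^n t_i e_i : \frac{a}{m}k_i\le t_i\le \frac{a}{m}(k_i+j) \text{ for all } i\}$ with integers $1\le j\le m$ and $0\le k_i\le m-j$ for $1\le i\le n$. Distinct such sets are counted separately (each once) in the arithmetic mean. A hypercube in $H$ is called normal-sized if its volume is $r_n a^n$, where $r_n=\lim_{m\to\infty}r_n(m)$. *)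

theory Defs
  imports "HOL-Analysis.Analysis"
begin

(* An orthonormal family of vectors of real^'n indexed by 'n itself has CARD('n) members,
   hence is automatically a basis. *)
definition orthonormal_basis :: "('n::finite \<Rightarrow> real^'n) \<Rightarrow> bool" where
  "orthonormal_basis e \<longleftrightarrow> (\<forall>i j. e i \<bullet> e j = (if i = j then 1 else 0))"

definition hypercube :: "real^'n \<Rightarrow> ('n::finite \<Rightarrow> real^'n) \<Rightarrow> real \<Rightarrow> (real^'n) set" where
  "hypercube v e a = {v + (\<Sum>i\<in>UNIV. t i *\<^sub>R e i) | t. \<forall>i. 0 \<le> t i \<and> t i \<le> a}"

definition is_hypercube :: "(real^'n::finite) set \<Rightarrow> bool" where
  "is_hypercube Q \<longleftrightarrow> (\<exists>v e b. orthonormal_basis e \<and> 0 < b \<and> Q = hypercube v e b)"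

definition grid_hypercube ::
  "real^'n \<Rightarrow> ('n::finite \<Rightarrow> real^'n) \<Rightarrow> real \<Rightarrow> nat \<Rightarrow> nat \<Rightarrow> ('n \<Rightarrow> nat) \<Rightarrow> (real^'n) set" where
  "grid_hypercube v e a m j k =
    {v + (\<Sum>i\<in>UNIV. t i *\<^sub>R e i) | t.
      \<forall>i. a / real m * real (k i) \<le> t i \<and> t i \<le> a / real m * real (k i + j)}"

(* A set of point sets, so distinct grid hypercubes are each counted exactly once.
   The bound k i \<le> m - j is written without truncated subtraction. *)
definition grid_hypercubes ::
  "real^'n \<Rightarrow> ('n::finite \<Rightarrow> real^'n) \<Rightarrow> real \<Rightarrow> nat \<Rightarrow> (real^'n) set set" where
  "grid_hypercubes v e a m =
    {grid_hypercube v e a m j k | j k. 1 \<le> j \<and> j \<le> m \<and> (\<forall>i. k i + j \<le> m)}"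

definition mean_volume :: "(real^'n::finite) set set \<Rightarrow> real" where
  "mean_volume \<G> = (\<Sum>Q\<in>\<G>. measure lebesgue Q) / real (card \<G>)"

(* Only m \<ge> 1 is meaningful; the value at m = 0 is the junk value 0 and does not affect limits. *)
definition grid_ratio :: "real^'n \<Rightarrow> ('n::finite \<Rightarrow> real^'n) \<Rightarrow> real \<Rightarrow> nat \<Rightarrow> real" where
  "grid_ratio v e a m =
    mean_volume (grid_hypercubes v e a m) / measure lebesgue (hypercube v e a)"

definition limit_ratio :: "real^'n \<Rightarrow> ('n::finite \<Rightarrow> real^'n) \<Rightarrow> real \<Rightarrow> real" where
  "limit_ratio v e a = lim (\<lambda>m. grid_ratio v e a m)"

definition normal_sized ::
  "real^'n \<Rightarrow> ('n::finite \<Rightarrow> real^'n) \<Rightarrow> real \<Rightarrow> (real^'n) set \<Rightarrow> bool" where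
  "normal_sized v e a Q \<longleftrightarrow>
    is_hypercube Q \<and> Q \<subseteq> hypercube v e a \<and>
    measure lebesgue Q = limit_ratio v e a * a ^ CARD('n)"

end

theory Submission
  imports Defs "HOL-Real_Asymp.Real_Asymp"
begin

text \<open>Counting the \<open>(m - j + 1)\<^sup>n\<close> positions of a grid hypercube of edge \<open>a j / m\<close> gives
  \<open>r\<^sub>n(m) = (\<Sum>j. j\<^sup>n (m + 1 - j)\<^sup>n) / (m\<^sup>n \<Sum>j. j\<^sup>n)\<close>. Both sums are asymptotically
  Beta integrals: squeezing \<open>j\<^sup>n\<close> between \<open>n! (j choose n)\<close> and \<open>n! (j + n choose n)\<close> reduces them
  to the convolution identity \<open>\<Sum>j. (j choose a) (m - j choose b) = (m + 1 choose a + b + 1)\<close>, so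
  that \<open>\<Sum>j\<le>m. j\<^sup>a (m - j)\<^sup>b\<close> divided by \<open>m^(a + b + 1)\<close> tends to \<open>a! b! / (a + b + 1)!\<close>.\<close>

section \<open>Convolution of binomials and asymptotics of power sums\<close>

text \<open>Classify the \<open>(a + b + 1)\<close>-subsets of an \<open>(m + 1)\<close>-set by
  their \<open>(a + 1)\<close>-st smallest element. The induction instead applies Pascal's rule to
  the second factor, which lowers \<open>m\<close>; \<open>b\<close> is general because both
  \<open>c\<close> and \<open>Suc c\<close> occur.\<close>

lemma sum_choose_mult_choose:
  "(\<Sum>j\<le>m. (j choose a) * ((m - j) choose b)) = (Suc m choose (a + b + 1))"
proof (induction m arbitrary: b)
  case 0
  then show ?case by (cases a; cases b) auto
next
  case (Suc m)
  show ?case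
  proof (cases b)
    case 0
    then show ?thesis using sum_choose_upper[of a "Suc m"] by (simp add: atMost_atLeast0)
  next
    case (Suc c)
    have "(\<Sum>j\<le>Suc m. (j choose a) * ((Suc m - j) choose b))
        = (\<Sum>j\<le>m. (j choose a) * ((m - j) choose c) + (j choose a) * ((m - j) choose Suc c))"
      by (simp add: Suc Suc_diff_le distrib_left)
    also have "\<dots> = (Suc m choose (a + c + 1)) + (Suc m choose (a + Suc c + 1))"
      by (simp only: sum.distrib Suc.IH)
    finally show ?thesis by (simp add: Suc)
  qed
qed

text \<open>The right-hand side is the rising product
  \<open>(j + 1) * ... * (j + n)\<close>.\<close>

lemma power_le_fact_mult_choose: "j ^ n \<le> fact n * ((j + n) choose n)"
proof (induction n)
  case (Suc n)
  have "j ^ Suc n \<le> (j + Suc n) * (fact n * ((j + n) choose n))"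
    using mult_le_mono[OF _ Suc.IH, of j "j + Suc n"] by simp
  also have "\<dots> = fact n * (Suc n * (Suc (j + n) choose Suc n))"
    by (simp only: Suc_times_binomial add_Suc_right mult.left_commute)
  also have "\<dots> = fact (Suc n) * ((j + Suc n) choose Suc n)"
    by (simp only: fact_Suc of_nat_id add_Suc_right mult_ac)
  finally show ?case .
qed simp

text \<open>The shift \<open>c\<close> lets one limit serve both the lower and the upper bound on
  \<open>power_sum\<close>.\<close>

lemma choose_over_power_tendsto:
  "(\<lambda>m. real ((m + c) choose k) / real m ^ k) \<longlonglongrightarrow> 1 / fact k"
proof (induction k)
  case (Suc k)
  have "(\<lambda>m. (real m + real c - real k) / real m) \<longlonglongrightarrow> 1"
    by real_asymp
  from tendsto_divide[OF tendsto_mult[OF Suc.IH this] tendsto_const[of "real (Suc k)"]]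
  have "(\<lambda>m. real ((m + c) choose k) / real m ^ k * ((real m + real c - real k) / real m)
      / real (Suc k)) \<longlonglongrightarrow> 1 / fact k * 1 / real (Suc k)"
    by simp
  moreover have "real ((m + c) choose k) / real m ^ k * ((real m + real c - real k) / real m)
      / real (Suc k) = real ((m + c) choose Suc k) / real m ^ Suc k" for m
  proof -
    \<comment> \<open>The difference is taken in the reals, so the identity also covers
      \<open>k > m + c\<close>, where both binomials vanish.\<close>
    have "real (Suc k) * real ((m + c) choose Suc k)
        = (real m + real c - real k) * real ((m + c) choose k)"
      unfolding binomial_gbinomial
      using gbinomial_absorption[of k "real (m + c)"] gbinomial_absorb_comp[of "real (m + c)" k]
      by simp
    then have "real ((m + c) choose Suc k)
        = (real m + real c - real k) * real ((m + c) choose k) / real (Suc k)"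
      by (simp only: nonzero_eq_divide_eq of_nat_neq_0 mult.commute not_False_eq_True)
    then show ?thesis by (simp only: power_Suc) (simp add: mult_ac)
  qed
  moreover have "1 / fact k * 1 / real (Suc k) = 1 / fact (Suc k)"
    by simp
  ultimately show ?case by (simp only:)
qed simp

text \<open>A discrete Beta integral. Since \<open>0 ^ 0 = 1\<close>, the case \<open>b = 0\<close>
  is the plain power sum, so numerator and denominator of the ratio are both instances.\<close>

definition power_sum :: "nat \<Rightarrow> nat \<Rightarrow> nat \<Rightarrow> nat" where
  "power_sum a b m = (\<Sum>j\<le>m. j ^ a * (m - j) ^ b)"

lemma power_sum_lower: "fact a * fact b * ((m + 1) choose (a + b + 1)) \<le> power_sum a b m"
proof -
  have "fact a * fact b * ((m + 1) choose (a + b + 1))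
      = (\<Sum>j\<le>m. fact a * (j choose a) * (fact b * ((m - j) choose b)))"
    using sum_choose_mult_choose[where m=m and a=a and b=b, symmetric]
    by (simp add: sum_distrib_left mult_ac)
  also have "\<dots> \<le> power_sum a b m"
    unfolding power_sum_def
    by (intro sum_mono mult_le_mono) (use binomial_fact_pow in \<open>simp_all add: mult.commute\<close>)
  finally show ?thesis .
qed

lemma power_sum_upper:
  "power_sum a b m \<le> fact a * fact b * ((m + (a + b + 1)) choose (a + b + 1))"
proof -
  \<comment> \<open>At \<open>j + a\<close> the upper entries of the binomials are
    \<open>j + a\<close> and \<open>m - j + b\<close>. Their sum \<open>m + a + b\<close> does not
    depend on \<open>j\<close>, so enlarging the range gives a full convolution.\<close>
  let ?f = "\<lambda>j. fact a * (j choose a) * (fact b * ((m + a + b - j) choose b))"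
  have "power_sum a b m \<le> (\<Sum>j\<le>m. ?f (j + a))"
    unfolding power_sum_def
  proof (intro sum_mono)
    fix j assume "j \<in> {..m}"
    then have eq: "m + a + b - (j + a) = m - j + b" by simp
    show "j ^ a * (m - j) ^ b \<le> ?f (j + a)"
      unfolding eq by (intro mult_le_mono power_le_fact_mult_choose)
  qed
  also have "\<dots> = sum ?f ((\<lambda>j. j + a) ` {..m})"
    by (subst sum.reindex) simp_all
  also have "\<dots> \<le> sum ?f {..m + a + b}"
    by (intro sum_mono2) auto
  also have "\<dots> = fact a * fact b * ((m + (a + b + 1)) choose (a + b + 1))"
    using sum_choose_mult_choose[where m="m+a+b" and a=a and b=b, symmetric]
    by (simp add: sum_distrib_left mult_ac add_ac)
  finally show ?thesis .
qed

lemma power_sum_tendsto: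
  "(\<lambda>m. real (power_sum a b m) / real m ^ (a + b + 1)) \<longlonglongrightarrow> fact a * fact b / fact (a + b + 1)"
proof (rule tendsto_sandwich)
  have lim: "(\<lambda>m. fact a * fact b * (real ((m + c) choose (a + b + 1)) / real m ^ (a + b + 1)))
      \<longlonglongrightarrow> fact a * fact b / fact (a + b + 1)" for c
    using tendsto_mult_left[OF choose_over_power_tendsto[of c "a + b + 1"], of "fact a * fact b"]
    by simp
  show "(\<lambda>m. fact a * fact b * (real ((m + 1) choose (a + b + 1)) / real m ^ (a + b + 1)))
      \<longlonglongrightarrow> fact a * fact b / fact (a + b + 1)" by (rule lim)
  show "(\<lambda>m. fact a * fact b * (real ((m + (a + b + 1)) choose (a + b + 1)) / real m ^ (a + b + 1)))
      \<longlonglongrightarrow> fact a * fact b / fact (a + b + 1)" by (rule lim)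
  have "fact a * fact b * real ((m + 1) choose (a + b + 1)) \<le> real (power_sum a b m)" for m
    using of_nat_mono[OF power_sum_lower[of a b m], where 'a=real] by simp
  then show "\<forall>\<^sub>F m in sequentially. fact a * fact b * (real ((m + 1) choose (a + b + 1))
      / real m ^ (a + b + 1)) \<le> real (power_sum a b m) / real m ^ (a + b + 1)"
    unfolding times_divide_eq_right by (intro always_eventually allI divide_right_mono) auto
  have "real (power_sum a b m) \<le> fact a * fact b * real ((m + (a + b + 1)) choose (a + b + 1))" for m
    using of_nat_mono[OF power_sum_upper[of a b m], where 'a=real] by simp
  then show "\<forall>\<^sub>F m in sequentially. real (power_sum a b m) / real m ^ (a + b + 1)
      \<le> fact a * fact b * (real ((m + (a + b + 1)) choose (a + b + 1)) / real m ^ (a + b + 1))"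
    unfolding times_divide_eq_right by (intro always_eventually allI divide_right_mono) auto
qed

section \<open>Invariance of Lebesgue measure under orthogonal maps\<close>

lemma nn_integral_lborel_translate:
  fixes c :: "'a::euclidean_space"
  assumes [measurable]: "f \<in> borel_measurable borel"
  shows "(\<integral>\<^sup>+ x. f (c + x) \<partial>lborel) = (\<integral>\<^sup>+ x. f x \<partial>lborel)"
  by (subst (2) lborel_distr_plus[of c, symmetric]) (simp add: nn_integral_distr)

text \<open>The library's \<open>measure_orthogonal_image\<close> requires a well-ordered index type. Without it,
  orthogonal maps \<open>T\<close> are handled by evaluating \<open>\<integral>\<integral> 1\<^sub>A(T x) 1\<^sub>B(T x + y) dy dx\<close> in both orders,
  where \<open>B\<close> is the unit ball; the reflection of \<open>A\<close> that appears is removed afterwards by the case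
  \<open>T = id\<close>.\<close>

lemma emeasure_vimage_orthogonal_reflect:
  fixes T :: "'a::euclidean_space \<Rightarrow> 'a"
  assumes T: "orthogonal_transformation T" and A[measurable]: "A \<in> sets borel"
  shows "emeasure lborel (T -` A) = emeasure lborel (uminus -` A)"
proof -
  define B :: "'a set" where "B = ball 0 1"
  have B[measurable]: "B \<in> sets borel" by (simp add: B_def)
  have lin: "linear T" using T by (rule orthogonal_transformation_linear)
  have [measurable]: "T \<in> borel_measurable borel"
    using lin by (intro borel_measurable_continuous_onI linear_continuous_on)
      (simp add: linear_conv_bounded_linear)
  have TB: "T -` B = B"
    using orthogonal_transformation_norm[OF T] by (auto simp: B_def)
  have vimage_integral: "(\<integral>\<^sup>+ x. indicator C (f x) \<partial>lborel) = emeasure lborel (f -` C)"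
    if "f \<in> borel_measurable borel" "C \<in> sets borel" for f :: "'a \<Rightarrow> 'a" and C
    using measurable_sets[OF that]
    by (simp add: nn_integral_indicator[symmetric] indicator_vimage)
  have "emeasure lborel (T -` A) * emeasure lborel B
      = (\<integral>\<^sup>+ x. indicator A (T x) * emeasure lborel B \<partial>lborel)"
    by (simp add: nn_integral_multc vimage_integral)
  also have "\<dots> = (\<integral>\<^sup>+ x. \<integral>\<^sup>+ y. indicator A (T x) * indicator B (T x + y) \<partial>lborel \<partial>lborel)"
    by (simp add: nn_integral_cmult nn_integral_lborel_translate[of "indicator B"])
  also have "\<dots> = (\<integral>\<^sup>+ y. \<integral>\<^sup>+ x. indicator A (T x) * indicator B (T x + y) \<partial>lborel \<partial>lborel)"
    by (intro lborel_pair.Fubini') measurable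
  also have "\<dots> = (\<integral>\<^sup>+ y. \<integral>\<^sup>+ x. indicator A (T x - y) * indicator B (T x) \<partial>lborel \<partial>lborel)"
  proof (rule nn_integral_cong)
    fix y :: 'a
    \<comment> \<open>Translating \<open>x\<close> by this \<open>z\<close> turns
      \<open>T x + y\<close> into \<open>T x\<close> and \<open>T x\<close> into
      \<open>T x - y\<close>.\<close>
    obtain z where z: "T z = - y"
      using orthogonal_transformation_surj[OF T] by (metis surjD)
    show "(\<integral>\<^sup>+ x. indicator A (T x) * indicator B (T x + y) \<partial>lborel)
        = (\<integral>\<^sup>+ x. indicator A (T x - y) * indicator B (T x) \<partial>lborel)"
      by (subst nn_integral_lborel_translate[of _ z, symmetric]) (simp_all add: linear_add[OF lin] z)
  qed
  also have "\<dots> = (\<integral>\<^sup>+ x. \<integral>\<^sup>+ y. indicator A (T x - y) * indicator B (T x) \<partial>lborel \<partial>lborel)"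
    by (intro lborel_pair.Fubini') measurable
  also have "\<dots> = (\<integral>\<^sup>+ x. emeasure lborel (uminus -` A) * indicator B (T x) \<partial>lborel)"
  proof (rule nn_integral_cong)
    fix x
    have "(\<integral>\<^sup>+ y. indicator A (T x - y) \<partial>lborel) = (\<integral>\<^sup>+ y. indicator A (- y) \<partial>lborel)"
      by (subst nn_integral_lborel_translate[of _ "T x", symmetric]) simp_all
    then show "(\<integral>\<^sup>+ y. indicator A (T x - y) * indicator B (T x) \<partial>lborel)
        = emeasure lborel (uminus -` A) * indicator B (T x)"
      by (simp add: nn_integral_multc vimage_integral)
  qed
  \<comment> \<open>The ball is invariant under \<open>T\<close>, so the factor of the opening
    product reappears and can be cancelled.\<close>
  also have "\<dots> = emeasure lborel (uminus -` A) * emeasure lborel B"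
    by (simp add: nn_integral_cmult vimage_integral TB)
  finally have "emeasure lborel B * emeasure lborel (T -` A)
      = emeasure lborel B * emeasure lborel (uminus -` A)"
    by (simp only: mult.commute)
  moreover have "emeasure lborel B \<noteq> 0" "emeasure lborel B \<noteq> \<infinity>"
    using content_ball_pos[of 1 "0::'a"] emeasure_lborel_ball_finite[of "0::'a" 1]
    by (auto simp: B_def measure_def)
  ultimately show ?thesis
    by (simp add: ennreal_mult_cancel_left)
qed

lemma emeasure_vimage_orthogonal:
  fixes T :: "'a::euclidean_space \<Rightarrow> 'a"
  assumes "orthogonal_transformation T" and "A \<in> sets borel"
  shows "emeasure lborel (T -` A) = emeasure lborel A"
  using emeasure_vimage_orthogonal_reflect[OF assms]
    emeasure_vimage_orthogonal_reflect[OF orthogonal_transformation_id assms(2)]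
  by (simp add: vimage_def)

lemma measure_orthogonal_image_compact:
  fixes T :: "'a::euclidean_space \<Rightarrow> 'a"
  assumes T: "orthogonal_transformation T" and "compact C"
  shows "measure lebesgue (T ` C) = measure lebesgue C"
proof -
  have "compact (T ` C)"
    using assms orthogonal_transformation_linear[OF T]
    by (intro compact_continuous_image linear_continuous_on) (simp_all add: linear_conv_bounded_linear)
  then have borel: "C \<in> sets borel" "T ` C \<in> sets borel"
    using \<open>compact C\<close> by (auto intro: borel_compact)
  have "T -` (T ` C) = C"
    using orthogonal_transformation_inj[OF T] by (rule inj_vimage_image_eq)
  with emeasure_vimage_orthogonal[OF T borel(2)] borel show ?thesis
    by (simp add: measure_def)
qed

section \<open>Boxes in an orthonormal frame\<close>

definition frame_map :: "('n::finite \<Rightarrow> real^'n) \<Rightarrow> real^'n \<Rightarrow> real^'n" where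
  "frame_map e x = (\<Sum>i\<in>UNIV. x $ i *\<^sub>R e i)"

lemma orthogonal_transformation_frame_map:
  assumes "orthonormal_basis e"
  shows "orthogonal_transformation (frame_map e)"
  unfolding orthogonal_transformation_def
proof safe
  show "linear (frame_map e)"
    unfolding frame_map_def
    by (intro linearI) (simp_all add: algebra_simps sum.distrib scaleR_sum_right)
  fix x y :: "real^'a"
  have "frame_map e x \<bullet> frame_map e y = (\<Sum>i\<in>UNIV. \<Sum>j\<in>UNIV. y $ i * (x $ j * (e j \<bullet> e i)))"
    unfolding frame_map_def inner_sum_right
    by (simp only: inner_sum_left inner_scaleR_left inner_scaleR_right sum_distrib_left)
  also have "\<dots> = (\<Sum>i\<in>UNIV. \<Sum>j\<in>UNIV. if j = i then y $ i * x $ j else 0)"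
    using assms by (intro sum.cong refl) (simp add: orthonormal_basis_def)
  also have "\<dots> = x \<bullet> y"
    by (simp add: inner_vec_def mult.commute)
  finally show "frame_map e x \<bullet> frame_map e y = x \<bullet> y" .
qed

text \<open>\<open>hypercube\<close> and \<open>grid_hypercube\<close> both have this form, so their
  volumes and their equality can be read off from coordinate boxes.\<close>

lemma frame_box_eq_image:
  "{v + (\<Sum>i\<in>UNIV. t i *\<^sub>R e i) | t. \<forall>i. l i \<le> t i \<and> t i \<le> u i}
    = (\<lambda>x. v + frame_map e x) ` cbox (\<chi> i. l i) (\<chi> i. u i)"
  (is "?A = ?B")
proof (intro equalityI subsetI)
  fix y assume "y \<in> ?A"
  then obtain t where "y = v + (\<Sum>i\<in>UNIV. t i *\<^sub>R e i)" "\<forall>i. l i \<le> t i \<and> t i \<le> u i"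
    by blast
  then show "y \<in> ?B"
    by (intro image_eqI[where x = "\<chi> i. t i"]) (auto simp: frame_map_def mem_box_cart)
next
  fix y assume "y \<in> ?B"
  then show "y \<in> ?A" by (auto simp: frame_map_def mem_box_cart)
qed

lemma measure_frame_box:
  fixes v :: "real^'n::finite"
  assumes "orthonormal_basis e" and "\<And>i. l i \<le> u i"
  shows "measure lebesgue {v + (\<Sum>i\<in>UNIV. t i *\<^sub>R e i) | t. \<forall>i. l i \<le> t i \<and> t i \<le> u i}
    = (\<Prod>i\<in>UNIV. u i - l i)"
proof -
  have "measure lebesgue ((+) v ` (frame_map e ` cbox (\<chi> i. l i) (\<chi> i. u i)))
      = measure lebesgue (cbox (\<chi> i. l i) (\<chi> i. u i) :: (real^'n) set)"
    using orthogonal_transformation_frame_map[OF assms(1)]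
    unfolding measure_translation
    by (intro measure_orthogonal_image_compact) auto
  also have "\<dots> = (\<Prod>i\<in>UNIV. u i - l i)"
    using assms(2) by (auto simp: content_cbox_if_cart interval_eq_empty_cart not_less[symmetric])
  finally show ?thesis by (simp add: frame_box_eq_image image_image)
qed

text \<open>The affine frame map is injective, so the coordinate boxes agree, and a nonempty box
  determines its corners.\<close>

lemma frame_box_eq_iff:
  fixes v :: "real^'n::finite"
  assumes "orthonormal_basis e" and "\<And>i. l i \<le> u i" and "\<And>i. l' i \<le> u' i"
    and "{v + (\<Sum>i\<in>UNIV. t i *\<^sub>R e i) | t. \<forall>i. l i \<le> t i \<and> t i \<le> u i}
      = {v + (\<Sum>i\<in>UNIV. t i *\<^sub>R e i) | t. \<forall>i. l' i \<le> t i \<and> t i \<le> u' i}"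
  shows "l = l' \<and> u = u'"
proof -
  have "inj (\<lambda>x. v + frame_map e x)"
    using orthogonal_transformation_inj[OF orthogonal_transformation_frame_map[OF assms(1)]]
    by (auto simp: inj_def)
  then have eq: "cbox (\<chi> i. l i) (\<chi> i. u i) = cbox (\<chi> i. l' i) (\<chi> i. u' i)"
    using assms(4) unfolding frame_box_eq_image by (simp add: inj_image_eq_iff)
  have "cbox (\<chi> i. l i) (\<chi> i. u i) \<noteq> {}"
    using assms(2) by (auto simp: interval_eq_empty_cart not_less)
  with eq have "(\<chi> i. l i) = (\<chi> i. l' i)" "(\<chi> i. u i) = (\<chi> i. u' i)"
    by (auto simp: eq_cbox)
  then show ?thesis by (auto simp: vec_eq_iff)
qed

lemma measure_hypercube:
  fixes v :: "real^'n::finite"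
  assumes "orthonormal_basis e" and "0 < a"
  shows "measure lebesgue (hypercube v e a) = a ^ CARD('n)"
  using measure_frame_box[OF assms(1), of "\<lambda>_. 0" "\<lambda>_. a" v] assms(2)
  by (simp add: hypercube_def)

lemma measure_grid_hypercube:
  fixes v :: "real^'n::finite"
  assumes "orthonormal_basis e" and "0 < a"
  shows "measure lebesgue (grid_hypercube v e a m j k) = (a / real m * real j) ^ CARD('n)"
  using measure_frame_box[OF assms(1), of "\<lambda>i. a / real m * real (k i)"
      "\<lambda>i. a / real m * real (k i + j)" v] assms(2)
  by (simp add: grid_hypercube_def divide_right_mono flip: right_diff_distrib diff_divide_distrib)

section \<open>Enumeration of the grid hypercubes\<close>

definition grid_index :: "nat \<Rightarrow> (nat \<times> ('n::finite \<Rightarrow> nat)) set" where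
  "grid_index m = Sigma {1..m} (\<lambda>j. {k. \<forall>i. k i + j \<le> m})"

text \<open>This turns sums over the set of grid hypercubes into sums over pairs
  \<open>(j, k)\<close>, with no set counted twice. The corners give back \<open>k\<close> and then
  \<open>j\<close>, because \<open>a / real m\<close> is nonzero.\<close>

lemma inj_on_grid_hypercube:
  assumes "orthonormal_basis e" and "0 < a" and "0 < m"
  shows "inj_on (\<lambda>(j, k). grid_hypercube v e a m j k) (grid_index m)"
proof (rule inj_onI, clarify)
  fix j k j' k'
  assume "grid_hypercube v e a m j k = grid_hypercube v e a m j' k'"
  then have "(\<lambda>i. a / real m * real (k i)) = (\<lambda>i. a / real m * real (k' i)) \<and>
      (\<lambda>i. a / real m * real (k i + j)) = (\<lambda>i. a / real m * real (k' i + j'))"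
    unfolding grid_hypercube_def using assms
    by (intro frame_box_eq_iff[OF assms(1)]) (auto intro!: mult_left_mono divide_right_mono)
  then show "j = j' \<and> k = k'"
    using assms by (auto simp: fun_eq_iff)
qed

lemma card_grid_positions:
  assumes "j \<le> m"
  shows "card {k :: 'n::finite \<Rightarrow> nat. \<forall>i. k i + j \<le> m} = (Suc m - j) ^ CARD('n)"
proof -
  have "{k :: 'n \<Rightarrow> nat. \<forall>i. k i + j \<le> m} = (\<Pi>\<^sub>E i\<in>UNIV. {..m - j})"
    using assms by (auto simp: PiE_def Pi_def le_diff_conv2)
  then show ?thesis using assms by (simp add: card_PiE Suc_diff_le)
qed

lemma sum_grid_index:
  fixes f :: "nat \<Rightarrow> real"
  shows "(\<Sum>(j, k :: 'n::finite \<Rightarrow> nat)\<in>grid_index m. f j)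
    = (\<Sum>j=1..m. real ((Suc m - j) ^ CARD('n)) * f j)"
proof -
  \<comment> \<open>Finiteness follows from positive cardinality, as infinite sets have
    \<open>card\<close> 0.\<close>
  have "finite {k :: 'n \<Rightarrow> nat. \<forall>i. k i + j \<le> m}" if "j \<in> {1..m}" for j
    using card_grid_positions[of j m, where 'n='n] that by (intro card_ge_0_finite) simp
  then show ?thesis
    unfolding grid_index_def
    by (subst sum.Sigma[symmetric]) (auto simp: card_grid_positions simp del: of_nat_power intro!: sum.cong)
qed

text \<open>The factor \<open>a ^ n\<close> cancels. The numerator is taken at \<open>Suc m\<close>
  because edge length \<open>j\<close> leaves \<open>Suc m - j\<close> positions per
  coordinate.\<close>

lemma grid_ratio_eq:
  fixes v :: "real^'n::finite"
  assumes "orthonormal_basis e" and "0 < a" and "0 < m"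
  defines "n \<equiv> CARD('n)"
  shows "grid_ratio v e a m
    = (real (power_sum n n (Suc m)) / real m ^ n) / real (power_sum n 0 m)"
proof -
  have n: "0 < n" by (simp add: n_def)
  have img: "grid_hypercubes v e a m = (\<lambda>(j, k). grid_hypercube v e a m j k) ` grid_index m"
    unfolding grid_hypercubes_def grid_index_def by (auto simp: image_iff; fastforce)
  have "(\<Sum>Q\<in>grid_hypercubes v e a m. measure lebesgue Q)
      = (\<Sum>(j, k :: 'n \<Rightarrow> nat)\<in>grid_index m. (a / real m * real j) ^ n)"
    unfolding img by (subst sum.reindex[OF inj_on_grid_hypercube[OF assms(1-3)]])
      (auto simp: measure_grid_hypercube[OF assms(1,2)] n_def case_prod_beta intro!: sum.cong)
  also have "\<dots> = (\<Sum>j=1..m. real ((Suc m - j) ^ n) * (a / real m * real j) ^ n)"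
    unfolding n_def by (rule sum_grid_index)
  also have "\<dots> = (a / real m) ^ n * (\<Sum>j=1..m. real (j ^ n * (Suc m - j) ^ n))"
    unfolding sum_distrib_left
    by (intro sum.cong refl) (simp only: of_nat_mult of_nat_power power_mult_distrib mult_ac)
  \<comment> \<open>The added terms \<open>j = 0\<close> and \<open>j = Suc m\<close> vanish because
    \<open>n > 0\<close>.\<close>
  also have "(\<Sum>j=1..m. real (j ^ n * (Suc m - j) ^ n)) = real (power_sum n n (Suc m))"
    unfolding power_sum_def of_nat_sum using n
    by (intro sum.mono_neutral_left) (auto simp: not_le)
  finally have num: "(\<Sum>Q\<in>grid_hypercubes v e a m. measure lebesgue Q)
      = (a / real m) ^ n * real (power_sum n n (Suc m))" .
  have "real (card (grid_hypercubes v e a m)) = (\<Sum>(j, k :: 'n \<Rightarrow> nat)\<in>grid_index m. 1)"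
    unfolding img by (subst card_image[OF inj_on_grid_hypercube[OF assms(1-3)]])
      (simp add: case_prod_beta)
  also have "\<dots> = (\<Sum>j=1..m. real ((Suc m - j) ^ n))"
    using sum_grid_index[of "\<lambda>_. 1" m, where 'n='n] by (simp add: n_def)
  \<comment> \<open>Reversing the summation replaces \<open>Suc m - j\<close> by
    \<open>j\<close>.\<close>
  also have "\<dots> = (\<Sum>j=1..m. real (j ^ n))"
    by (subst sum.atLeastAtMost_rev) (intro sum.cong, auto)
  also have "\<dots> = real (power_sum n 0 m)"
    unfolding power_sum_def of_nat_sum using n
    by (intro sum.mono_neutral_cong_left) (auto simp: not_le)
  finally have card: "real (card (grid_hypercubes v e a m)) = real (power_sum n 0 m)" .
  show ?thesis
    unfolding grid_ratio_def mean_volume_def num card measure_hypercube[OF assms(1,2)] n_def[symmetric]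
    using assms(2) by (simp add: power_divide)
qed

section \<open>The limit of the ratio\<close>

lemma grid_ratio_tendsto:
  fixes v :: "real^'n::finite"
  assumes "orthonormal_basis e" and "0 < a"
  shows "grid_ratio v e a \<longlonglongrightarrow> 1 / real ((2 * CARD('n) + 1) choose CARD('n))"
proof -
  define n where "n = CARD('n)"
  define N where "N m = real (power_sum n n m) / real m ^ (n + n + 1)" for m
  define D where "D m = real (power_sum n 0 m) / real m ^ (n + 0 + 1)" for m
  have N: "(\<lambda>m. N (Suc m)) \<longlonglongrightarrow> fact n * fact n / fact (n + n + 1)"
    unfolding N_def by (intro LIMSEQ_Suc power_sum_tendsto)
  have D: "D \<longlonglongrightarrow> fact n * fact 0 / fact (n + 0 + 1)"
    unfolding D_def by (rule power_sum_tendsto)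
  \<comment> \<open>\<open>N (Suc m)\<close> is normalised by a power of \<open>Suc m\<close>, but
    the ratio needs a power of \<open>m\<close>; the correction factor tends to 1.\<close>
  have "(\<lambda>m. real (Suc m) / real m) \<longlonglongrightarrow> 1"
    by real_asymp
  then have "(\<lambda>m. N (Suc m) * (real (Suc m) / real m) ^ (n + n + 1) / D m) \<longlonglongrightarrow>
      fact n * fact n / fact (n + n + 1) * 1 ^ (n + n + 1) / (fact n * fact 0 / fact (n + 0 + 1))"
    by (intro tendsto_intros N D) simp_all
  \<comment> \<open>The quotient of the two Beta values is
    \<open>n! (n + 1)! / (2 n + 1)!\<close>.\<close>
  moreover have "fact n * fact n / fact (n + n + 1) * 1 ^ (n + n + 1)
      / (fact n * fact 0 / fact (n + 0 + 1)) = 1 / real ((2 * n + 1) choose n)"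
  proof -
    have "n \<le> n + n + 1" "n + n + 1 - n = n + 1" by simp_all
    then have "real ((n + n + 1) choose n) = fact (n + n + 1) / (fact n * fact (n + 1))"
      using binomial_fact[of n "n + n + 1", where 'a=real] by (simp only:)
    then show ?thesis by (simp only: mult_2 power_one fact_0 add_0_right mult_1_right) simp
  qed
  ultimately have lim: "(\<lambda>m. N (Suc m) * (real (Suc m) / real m) ^ (n + n + 1) / D m)
      \<longlonglongrightarrow> 1 / real ((2 * n + 1) choose n)" by (simp only:)
  have "\<forall>\<^sub>F m in sequentially.
      N (Suc m) * (real (Suc m) / real m) ^ (n + n + 1) / D m = grid_ratio v e a m"
    using eventually_gt_at_top[of 0]
  proof eventually_elim
    case (elim m)
    have "N (Suc m) * (real (Suc m) / real m) ^ (n + n + 1)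
        = real (power_sum n n (Suc m)) / real m ^ (n + n + 1)"
      unfolding N_def power_divide by simp
    moreover have "real m ^ (n + n + 1) = real m ^ n * real m ^ (n + 0 + 1)"
      by (simp add: power_add)
    ultimately show ?case
      using elim unfolding grid_ratio_eq[OF assms elim] D_def n_def[symmetric]
      by simp
  qed
  with lim show ?thesis
    unfolding n_def by (rule Lim_transform_eventually)
qed

text \<open>Convergence is asserted separately because \<open>lim\<close> also assigns a value to
  divergent sequences. The last clause follows on dividing by the volume
  \<open>a ^ CARD('n)\<close>, which is positive.\<close>

theorem theorem2:
  fixes v :: "real^'n::finite" and e :: "'n \<Rightarrow> real^'n" and a :: real
  assumes "orthonormal_basis e" and "0 < a"
  shows "convergent (\<lambda>m. grid_ratio v e a m)
    \<and> limit_ratio v e a = 1 / real ((2 * CARD('n) + 1) choose CARD('n))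
    \<and> (\<forall>Q. normal_sized v e a Q \<longrightarrow>
          measure lebesgue Q / measure lebesgue (hypercube v e a) = limit_ratio v e a)"
  using grid_ratio_tendsto[OF assms, of v] measure_hypercube[OF assms, of v] assms(2)
  by (auto simp: limit_ratio_def normal_sized_def convergent_def dest: limI)

end
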